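(* Let $\Phi=(G,\varphi)$ be a distance compatible $\mathbb{T}$-gain graph on a connected simple graph $G$ with vertex set $\{v_1,\dots,v_n\}$, and let $\Psi=(G,\psi)$ be a $\mathbb{T}$-gain graph switching equivalent to $\Phi$. Then $\Psi$ is distance compatible and $\mathcal{DL}(\Phi)$ and $\mathcal{DL}(\Psi)$ have the same spectrum.
   Context: $\mathbb{T}=\{z\in\mathbb{C}:|z|=1\}$. A $\mathbb{T}$-gain graph $\Phi=(G,\varphi)$ assigns to each of the two orientations $\vec e_{i,j},\vec e_{j,i}$ of every edge $v_iv_j$ of $G$ a gain in $\mathbb{T}$ with $\varphi(\vec e_{j,i})=\overline{\varphi(\vec e_{i,j})}$; the gain of an oriented path is the product of the gains of its consecutive oriented edges. $\Phi=(G,\varphi)$ and $\Psi=(G,\psi)$ are switching equivalent if there is $\zeta:V(G)\to\mathbb{T}$ with $\varphi(\vec e_{i,j})=\zeta(v_i)^{-1}\psi(\vec e_{i,j})\zeta(v_j)$ for every edge $v_iv_j$. $d(u,v)$ is the shortest-path distance in $G$. For a total order $<$ and $s<t$, $\varphi^{<}_{\max}(s,t)$ (resp. $\varphi^{<}_{\min}(s,t)$) is the maximum (resp. minimum) of the gains of all shortest oriented paths from $s$ to $t$, with respect to the lexicographic order on $\mathbb{C}$ ($a+ib\le c+id$ iff $a<c$, or $a=c$ and $b\le d$); further $\varphi^{<}_{\max}(t,s)=\overline{\varphi^{<}_{\max}(s,t)}$, $\varphi^{<}_{\min}(t,s)=\overline{\varphi^{<}_{\min}(s,t)}$, and both vanish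 on pairs $(s,s)$. $\mathcal{D}^{\max}_{<}(\Phi)=(\varphi^{<}_{\max}(v_i,v_j)d(v_i,v_j))_{i,j}$, $\mathcal{D}^{\min}_{<}(\Phi)=(\varphi^{<}_{\min}(v_i,v_j)d(v_i,v_j))_{i,j}$. $\Phi$ is distance compatible if $\mathcal{D}^{\max}_{<}(\Phi)=\mathcal{D}^{\min}_{<}(\Phi)$ for the standard order $v_1<\dots<v_n$; the common matrix is $\mathcal{D}(\Phi)$, and $\mathcal{DL}(\Phi)=\mathrm{Tr}(G)-\mathcal{D}(\Phi)$, where $\mathrm{Tr}(G)=\mathrm{diag}(\mathrm{Tr}(v_1),\dots,\mathrm{Tr}(v_n))$ and $\mathrm{Tr}(v_i)=\sum_j d(v_i,v_j)$. *)

theory Defs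
  imports
    "Graph_Theory.Graph_Theory"
    "Jordan_Normal_Form.Char_Poly"
    "Jordan_Normal_Form.Spectral_Radius"
begin

text \<open>
  A simple graph is a \<^locale>\<open>pair_graph\<close>: a finite loopless digraph without parallel arcs whose
  arc relation is symmetric. The arcs \<open>(u, v)\<close> and \<open>(v, u)\<close> are the two orientations of an edge, so
  a gain function is a function on arcs. Only its values on arcs of \<open>G\<close> matter.
\<close>

definition gain_graph :: "'a pair_pre_digraph \<Rightarrow> ('a \<times> 'a \<Rightarrow> complex) \<Rightarrow> bool" where
  "gain_graph G \<phi> \<longleftrightarrow>
     (\<forall>(u, v) \<in> parcs G. cmod (\<phi> (u, v)) = 1 \<and> \<phi> (v, u) = cnj (\<phi> (u, v)))"

definition switching_equivalent ::
    "'a pair_pre_digraph \<Rightarrow> ('a \<times> 'a \<Rightarrow> complex) \<Rightarrow> ('a \<times> 'a \<Rightarrow> complex) \<Rightarrow> bool" where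
  "switching_equivalent G \<phi> \<psi> \<longleftrightarrow>
     (\<exists>\<zeta>. (\<forall>v \<in> pverts G. cmod (\<zeta> v) = 1) \<and>
          (\<forall>(u, v) \<in> parcs G. \<phi> (u, v) = inverse (\<zeta> u) * \<psi> (u, v) * \<zeta> v))"

definition path_gain :: "('a \<times> 'a \<Rightarrow> complex) \<Rightarrow> ('a \<times> 'a) list \<Rightarrow> complex" where
  "path_gain \<phi> p = prod_list (map \<phi> p)"

definition graph_dist :: "'a pair_pre_digraph \<Rightarrow> 'a \<Rightarrow> 'a \<Rightarrow> nat" where
  "graph_dist G u v = (LEAST k. \<exists>p. pre_digraph.apath (with_proj G) u p v \<and> length p = k)"

definition shortest_paths :: "'a pair_pre_digraph \<Rightarrow> 'a \<Rightarrow> 'a \<Rightarrow> ('a \<times> 'a) list set" where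
  "shortest_paths G u v =
     {p. pre_digraph.apath (with_proj G) u p v \<and> length p = graph_dist G u v}"

definition lex_le :: "complex \<Rightarrow> complex \<Rightarrow> bool" where
  "lex_le z w \<longleftrightarrow> Re z < Re w \<or> (Re z = Re w \<and> Im z \<le> Im w)"

text \<open>
  Greatest and least element of a finite nonempty set of complex numbers for the total order
  \<^const>\<open>lex_le\<close> (type \<^typ>\<open>complex\<close> is not an instance of \<^class>\<open>linorder\<close>).
\<close>

definition lex_Max :: "complex set \<Rightarrow> complex" where
  "lex_Max S = (THE z. z \<in> S \<and> (\<forall>w \<in> S. lex_le w z))"

definition lex_Min :: "complex set \<Rightarrow> complex" where
  "lex_Min S = (THE z. z \<in> S \<and> (\<forall>w \<in> S. lex_le z w))"

text \<open>In the next two definitions, \<open>lt\<close> is a strict total order on the vertices.\<close>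

definition gain_max :: "('a \<Rightarrow> 'a \<Rightarrow> bool) \<Rightarrow> 'a pair_pre_digraph \<Rightarrow> ('a \<times> 'a \<Rightarrow> complex) \<Rightarrow>
    'a \<Rightarrow> 'a \<Rightarrow> complex" where
  "gain_max lt G \<phi> s t =
     (if s = t then 0
      else if lt s t then lex_Max (path_gain \<phi> ` shortest_paths G s t)
      else cnj (lex_Max (path_gain \<phi> ` shortest_paths G t s)))"

definition gain_min :: "('a \<Rightarrow> 'a \<Rightarrow> bool) \<Rightarrow> 'a pair_pre_digraph \<Rightarrow> ('a \<times> 'a \<Rightarrow> complex) \<Rightarrow>
    'a \<Rightarrow> 'a \<Rightarrow> complex" where
  "gain_min lt G \<phi> s t =
     (if s = t then 0
      else if lt s t then lex_Min (path_gain \<phi> ` shortest_paths G s t)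
      else cnj (lex_Min (path_gain \<phi> ` shortest_paths G t s)))"

text \<open>
  The list \<open>vs\<close> is the enumeration \<open>v\<^sub>1, \<dots>, v\<^sub>n\<close> of the vertices; \<open>vs ! i\<close> is \<open>v\<^sub>i\<^sub>+\<^sub>1\<close>, as matrix
  indices start at 0.
\<close>

definition std_order :: "'a list \<Rightarrow> 'a \<Rightarrow> 'a \<Rightarrow> bool" where
  "std_order vs x y \<longleftrightarrow> (\<exists>i j. i < j \<and> j < length vs \<and> x = vs ! i \<and> y = vs ! j)"

definition dist_mat_max :: "('a \<Rightarrow> 'a \<Rightarrow> bool) \<Rightarrow> 'a pair_pre_digraph \<Rightarrow> 'a list \<Rightarrow>
    ('a \<times> 'a \<Rightarrow> complex) \<Rightarrow> complex mat" where
  "dist_mat_max lt G vs \<phi> = mat (length vs) (length vs)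
     (\<lambda>(i, j). gain_max lt G \<phi> (vs ! i) (vs ! j) * of_nat (graph_dist G (vs ! i) (vs ! j)))"

definition dist_mat_min :: "('a \<Rightarrow> 'a \<Rightarrow> bool) \<Rightarrow> 'a pair_pre_digraph \<Rightarrow> 'a list \<Rightarrow>
    ('a \<times> 'a \<Rightarrow> complex) \<Rightarrow> complex mat" where
  "dist_mat_min lt G vs \<phi> = mat (length vs) (length vs)
     (\<lambda>(i, j). gain_min lt G \<phi> (vs ! i) (vs ! j) * of_nat (graph_dist G (vs ! i) (vs ! j)))"

definition distance_compatible ::
    "'a pair_pre_digraph \<Rightarrow> 'a list \<Rightarrow> ('a \<times> 'a \<Rightarrow> complex) \<Rightarrow> bool" where
  "distance_compatible G vs \<phi> \<longleftrightarrow>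
     dist_mat_max (std_order vs) G vs \<phi> = dist_mat_min (std_order vs) G vs \<phi>"

text \<open>
  The gain distance matrix is the common value of the two matrices above. It is meaningful only
  for distance compatible gain graphs.
\<close>

definition gain_dist_mat ::
    "'a pair_pre_digraph \<Rightarrow> 'a list \<Rightarrow> ('a \<times> 'a \<Rightarrow> complex) \<Rightarrow> complex mat" where
  "gain_dist_mat G vs \<phi> = dist_mat_max (std_order vs) G vs \<phi>"

definition transmission :: "'a pair_pre_digraph \<Rightarrow> 'a \<Rightarrow> nat" where
  "transmission G v = (\<Sum>w \<in> pverts G. graph_dist G v w)"

definition transmission_mat :: "'a pair_pre_digraph \<Rightarrow> 'a list \<Rightarrow> complex mat" where
  "transmission_mat G vs = mat (length vs) (length vs)
     (\<lambda>(i, j). if i = j then of_nat (transmission G (vs ! i)) else 0)"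

definition gain_dist_laplacian ::
    "'a pair_pre_digraph \<Rightarrow> 'a list \<Rightarrow> ('a \<times> 'a \<Rightarrow> complex) \<Rightarrow> complex mat" where
  "gain_dist_laplacian G vs \<phi> = transmission_mat G vs - gain_dist_mat G vs \<phi>"

text \<open>
  The spectrum as a multiset, every eigenvalue counted with its algebraic multiplicity. The
  library's \<^const>\<open>spectrum\<close> is the underlying set.
\<close>

definition mspectrum :: "complex mat \<Rightarrow> complex multiset" where
  "mspectrum A = proots (char_poly A)"

lemma set_mspectrum:
  assumes A: "A \<in> carrier_mat n n"
  shows "set_mset (mspectrum A) = spectrum A"
proof -
  have "char_poly A \<noteq> 0"
    using degree_monic_char_poly[OF A] by auto
  then show ?thesis
    using eigenvalue_root_char_poly[OF A] by (auto simp: mspectrum_def spectrum_def)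
qed

end

theory Submission
  imports Defs
begin

text \<open>
  On a walk from \<open>s\<close> to \<open>t\<close> the switching factors telescope, so switching multiplies the gains of
  all shortest paths from \<open>s\<close> to \<open>t\<close> by one common factor \<open>\<zeta> s / \<zeta> t\<close>. Distance compatibility says
  that these gains all coincide, a property which survives multiplication by a common factor, and
  the Laplacians are conjugate by the diagonal matrix of the switching function.
\<close>

lemma lex_le_refl [simp]: "lex_le z z"
  by (simp add: lex_le_def)

lemma lex_le_linear: "lex_le z w \<or> lex_le w z"
  by (auto simp: lex_le_def)

lemma lex_le_trans: "lex_le x y \<Longrightarrow> lex_le y z \<Longrightarrow> lex_le x z"
  by (auto simp: lex_le_def)

lemma lex_le_antisym: "lex_le z w \<Longrightarrow> lex_le w z \<Longrightarrow> z = w"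
  by (auto simp: lex_le_def complex_eq_iff)

lemma ex_lex_greatest:
  assumes "finite S" "S \<noteq> {}"
  shows "\<exists>z\<in>S. \<forall>w\<in>S. lex_le w z"
  using assms
proof (induction rule: finite_ne_induct)
  case (insert x F)
  then obtain z where "z \<in> F" "\<forall>w\<in>F. lex_le w z"
    by blast
  then show ?case
    using lex_le_linear[of x z] lex_le_trans by (metis insert_iff lex_le_refl)
qed simp

lemma ex_lex_least:
  assumes "finite S" "S \<noteq> {}"
  shows "\<exists>z\<in>S. \<forall>w\<in>S. lex_le z w"
  using assms
proof (induction rule: finite_ne_induct)
  case (insert x F)
  then obtain z where "z \<in> F" "\<forall>w\<in>F. lex_le z w"
    by blast
  then show ?case
    using lex_le_linear[of x z] lex_le_trans by (metis insert_iff lex_le_refl)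
qed simp

text \<open>The description in \<open>lex_Max\<close> denotes: finiteness gives a greatest element,
  with \<open>w\<close> witnessing nonemptiness, and antisymmetry makes it unique.\<close>

lemma lex_Max_ge:
  assumes "finite S" "w \<in> S"
  shows "lex_le w (lex_Max S)"
proof -
  obtain z where "z \<in> S \<and> (\<forall>w\<in>S. lex_le w z)"
    using ex_lex_greatest[of S] assms by blast
  then have "lex_Max S \<in> S \<and> (\<forall>w\<in>S. lex_le w (lex_Max S))"
    unfolding lex_Max_def by (rule theI) (use \<open>z \<in> S \<and> _\<close> lex_le_antisym in blast)
  then show ?thesis
    using assms by blast
qed

lemma lex_Min_le:
  assumes "finite S" "w \<in> S"
  shows "lex_le (lex_Min S) w"
proof -
  obtain z where "z \<in> S \<and> (\<forall>w\<in>S. lex_le z w)"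
    using ex_lex_least[of S] assms by blast
  then have "lex_Min S \<in> S \<and> (\<forall>w\<in>S. lex_le (lex_Min S) w)"
    unfolding lex_Min_def by (rule theI) (use \<open>z \<in> S \<and> _\<close> lex_le_antisym in blast)
  then show ?thesis
    using assms by blast
qed

lemma lex_Max_singleton [simp]: "lex_Max {c} = c"
  by (auto simp: lex_Max_def)

lemma lex_Min_singleton [simp]: "lex_Min {c} = c"
  by (auto simp: lex_Min_def)

text \<open>Every element is squeezed between the two extremes. This turns distance compatibility
  into the statement that all shortest paths between two vertices have the same gain.\<close>

lemma lex_Max_eq_lex_Min_imp_singleton:
  assumes "finite S" "S \<noteq> {}" "lex_Max S = lex_Min S"
  shows "S = {lex_Max S}"
proof -
  have "w = lex_Max S" if "w \<in> S" for w
    using lex_Max_ge[OF assms(1) that] lex_Min_le[OF assms(1) that] assms(3)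
    by (auto intro: lex_le_antisym)
  with assms(2) show ?thesis
    by blast
qed

lemma finite_shortest_paths:
  assumes "pair_graph G"
  shows "finite (shortest_paths G u v)"
proof -
  interpret pair_graph G by fact
  show ?thesis
    using apaths_finite[of u v] by (rule rev_finite_subset) (auto simp: shortest_paths_def)
qed

lemma shortest_paths_nonempty:
  assumes "pair_graph G" "Digraph_Component.connected (with_proj G)"
    and "u \<in> pverts G" "v \<in> pverts G"
  shows "shortest_paths G u v \<noteq> {}"
proof -
  interpret pair_graph G by fact
  \<comment> \<open>Arcs come in opposite pairs, so connectedness already yields directed walks;
    shortcutting one to a path shows that the \<open>LEAST\<close> in \<open>graph_dist\<close> is
    attained.\<close>
  have "strongly_connected (with_proj G)"
    using symmetric_connected_imp_strongly_connected sym_arcs assms(2) by blast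
  then have "u \<rightarrow>\<^sup>*\<^bsub>with_proj G\<^esub> v"
    using assms(3,4) by (auto simp: strongly_connected_def)
  then obtain p where "apath u p v"
    using apath_awalk_to_apath reachable_awalk by blast
  then have "\<exists>k p. apath u p v \<and> length p = k"
    by blast
  then have "\<exists>p. apath u p v \<and> length p = graph_dist G u v"
    unfolding graph_dist_def by (rule LeastI_ex)
  then show ?thesis
    by (auto simp: shortest_paths_def)
qed

text \<open>Compatibility equates products of gain and distance; a nonzero distance lets the gains
  themselves be compared.\<close>

lemma graph_dist_neq_0:
  assumes "pair_graph G" "Digraph_Component.connected (with_proj G)"
    and "u \<in> pverts G" "v \<in> pverts G" "u \<noteq> v"
  shows "graph_dist G u v \<noteq> 0"
proof
  interpret pair_graph G by fact
  assume "graph_dist G u v = 0"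
  with shortest_paths_nonempty[OF assms(1-4)] have "apath u [] v"
    by (auto simp: shortest_paths_def)
  with assms(5) show False
    by (simp add: apath_Nil_iff)
qed

lemma path_gain_switch:
  assumes "pair_graph G"
    and \<zeta>: "\<And>v. v \<in> pverts G \<Longrightarrow> \<zeta> v \<noteq> 0"
    and sw: "\<And>u v. (u, v) \<in> parcs G \<Longrightarrow> \<phi> (u, v) = inverse (\<zeta> u) * \<psi> (u, v) * \<zeta> v"
    and p: "p \<in> shortest_paths G s t"
  shows "path_gain \<psi> p = \<zeta> s * path_gain \<phi> p * inverse (\<zeta> t)"
proof -
  interpret pair_graph G by fact
  \<comment> \<open>The induction runs over arbitrary walks with varying start vertex, since the
    tail of a walk is again a walk. At each step the factor \<open>inverse (\<zeta> v)\<close> of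
    the first arc cancels the \<open>\<zeta> v\<close> of the tail.\<close>
  have "path_gain \<psi> p = \<zeta> s * path_gain \<phi> p * inverse (\<zeta> t)" if "awalk s p t"
    using that
  proof (induction p arbitrary: s)
    case Nil
    then show ?case
      using \<zeta> by (auto simp: awalk_Nil_iff path_gain_def)
  next
    case (Cons e p)
    obtain u v where e: "e = (u, v)" by force
    from Cons.prems e have "(u, v) \<in> parcs G" "u = s" "awalk v p t"
      by (auto simp: awalk_Cons_iff)
    moreover from this have "u \<in> pverts G" "v \<in> pverts G"
      using in_arcsD1 in_arcsD2 by auto
    ultimately show ?case
      using Cons.IH[of v] \<zeta>[of u] \<zeta>[of v] sw[of u v] e
      by (simp add: path_gain_def)
  qed
  moreover have "awalk s p t"
    using p by (auto simp: shortest_paths_def apath_def)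
  ultimately show ?thesis
    by blast
qed

text \<open>Multiplying by a diagonal matrix on the left scales rows, on the right columns; the two
  diagonal matrices are mutually inverse because \<open>f\<close> does not vanish.\<close>

lemma similar_mat_diag_conjugate:
  fixes A B :: "'a::field mat"
  assumes "A \<in> carrier_mat n n" "B \<in> carrier_mat n n"
    and "\<And>i. i < n \<Longrightarrow> f i \<noteq> 0"
    and "\<And>i j. i < n \<Longrightarrow> j < n \<Longrightarrow> B $$ (i, j) = f i * A $$ (i, j) * inverse (f j)"
  shows "similar_mat B A"
proof (rule similar_matI)
  let ?P = "mat_diag n f" and ?Q = "mat_diag n (\<lambda>i. inverse (f i))"
  show "{B, A, ?P, ?Q} \<subseteq> carrier_mat n n"
    using assms by auto
  show "?P * ?Q = 1\<^sub>m n" "?Q * ?P = 1\<^sub>m n"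
    using assms(3) by (auto simp: mat_diag_diag, auto simp: mat_diag_def)
  show "B = ?P * A * ?Q"
    unfolding mat_diag_mult_left[OF assms(1)]
    by (subst mat_diag_mult_right[of _ n]) (use assms in auto)
qed

lemma std_order_nth_iff:
  assumes "distinct vs" "i < length vs" "j < length vs"
  shows "std_order vs (vs ! i) (vs ! j) \<longleftrightarrow> i < j"
  using assms by (auto simp: std_order_def nth_eq_iff_index_eq)

theorem theorem4p3:
  fixes G :: "'a pair_pre_digraph"
    and vs :: "'a list"
    and \<phi> \<psi> :: "'a \<times> 'a \<Rightarrow> complex"
  assumes "pair_graph G"
    and "Digraph_Component.connected (with_proj G)"
    and "distinct vs" and "set vs = pverts G"
    and "gain_graph G \<phi>"
    and "distance_compatible G vs \<phi>"
    and "gain_graph G \<psi>"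
    and "switching_equivalent G \<phi> \<psi>"
  shows "distance_compatible G vs \<psi> \<and>
    mspectrum (gain_dist_laplacian G vs \<phi>) = mspectrum (gain_dist_laplacian G vs \<psi>)"
proof
  define n where "n = length vs"
  let ?lt = "std_order vs"
  obtain \<zeta> where \<zeta>1: "\<And>v. v \<in> pverts G \<Longrightarrow> cmod (\<zeta> v) = 1"
    and sw: "\<And>u v. (u, v) \<in> parcs G \<Longrightarrow> \<phi> (u, v) = inverse (\<zeta> u) * \<psi> (u, v) * \<zeta> v"
    using assms(8) unfolding switching_equivalent_def by fast
  have \<zeta>0: "\<zeta> v \<noteq> 0" if "v \<in> pverts G" for v
    using \<zeta>1[OF that] by auto
  \<comment> \<open>Modulus 1 is used here beyond mere nonvanishing: it makes the switching formula
    stable under conjugation.\<close>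
  have cnj_\<zeta>: "cnj (\<zeta> v) = inverse (\<zeta> v)" if "v \<in> pverts G" for v
    using \<zeta>1[OF that] by (simp add: inverse_complex_def cmod_def complex_eq_iff)
  have verts: "vs ! i \<in> pverts G" if "i < n" for i
    using that assms(4) n_def by (metis nth_mem)
  have neq: "vs ! i \<noteq> vs ! j" if "i < j" "j < n" for i j
    using that assms(3) n_def by (auto simp: nth_eq_iff_index_eq)
  have lt: "?lt (vs ! i) (vs ! j) \<longleftrightarrow> i < j" if "i < n" "j < n" for i j
    using that assms(3) n_def by (simp add: std_order_nth_iff)

  \<comment> \<open>Only pairs above the diagonal are treated, as there the extremal gains are taken
    over the paths themselves; below the diagonal they are conjugates of these.\<close>
  have upper: "\<exists>c. path_gain \<phi> ` shortest_paths G (vs ! i) (vs ! j) = {c} \<and>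
      path_gain \<psi> ` shortest_paths G (vs ! i) (vs ! j) = {\<zeta> (vs ! i) * c * inverse (\<zeta> (vs ! j))}"
    if ij: "i < j" "j < n" for i j
  proof -
    let ?P = "shortest_paths G (vs ! i) (vs ! j)"
    have i: "i < n" using ij by simp
    have "gain_max ?lt G \<phi> (vs ! i) (vs ! j) * of_nat (graph_dist G (vs ! i) (vs ! j)) =
        gain_min ?lt G \<phi> (vs ! i) (vs ! j) * of_nat (graph_dist G (vs ! i) (vs ! j))"
      using arg_cong[OF assms(6)[unfolded distance_compatible_def], of "\<lambda>A. A $$ (i, j)"] i ij n_def
      by (simp add: dist_mat_max_def dist_mat_min_def)
    then have "lex_Max (path_gain \<phi> ` ?P) = lex_Min (path_gain \<phi> ` ?P)"
      using graph_dist_neq_0[OF assms(1,2) verts[OF i] verts[OF ij(2)] neq[OF ij]] neq[OF ij]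
        lt[OF i ij(2)] ij
      by (simp add: gain_max_def gain_min_def)
    then obtain c where c: "path_gain \<phi> ` ?P = {c}"
      using lex_Max_eq_lex_Min_imp_singleton[of "path_gain \<phi> ` ?P"]
        finite_shortest_paths[OF assms(1)]
        shortest_paths_nonempty[OF assms(1,2) verts[OF i] verts[OF ij(2)]] by blast
    have "path_gain \<psi> ` ?P =
        (\<lambda>z. \<zeta> (vs ! i) * z * inverse (\<zeta> (vs ! j))) ` path_gain \<phi> ` ?P"
      unfolding image_image
      by (rule image_cong) (simp_all add: path_gain_switch[where \<zeta> = \<zeta> and \<phi> = \<phi>, OF assms(1) \<zeta>0 sw])
    with c show ?thesis by auto
  qed

  have gain: "gain_max ?lt G \<psi> (vs ! i) (vs ! j) = gain_min ?lt G \<psi> (vs ! i) (vs ! j) \<and>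
      gain_max ?lt G \<psi> (vs ! i) (vs ! j) =
        \<zeta> (vs ! i) * gain_max ?lt G \<phi> (vs ! i) (vs ! j) * inverse (\<zeta> (vs ! j))"
    if i: "i < n" and j: "j < n" for i j
  proof (cases i j rule: linorder_cases)
    case less
    then show ?thesis
      using upper[OF less j] neq[OF less j] lt[OF i j] by (auto simp: gain_max_def gain_min_def)
  next
    case equal
    then show ?thesis
      by (simp add: gain_max_def gain_min_def)
  next
    \<comment> \<open>Conjugating the formula for \<open>(j, i)\<close> swaps the roles of \<zeta>
      and its inverse, which gives exactly the factor required for \<open>(i, j)\<close>.\<close>
    case greater
    then show ?thesis
      using upper[OF greater i] neq[OF greater i] lt[OF i j] cnj_\<zeta>[OF verts[OF i]] cnj_\<zeta>[OF verts[OF j]]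
      by (auto simp: gain_max_def gain_min_def)
  qed

  show "distance_compatible G vs \<psi>"
    unfolding distance_compatible_def dist_mat_max_def dist_mat_min_def
    using gain n_def by (intro eq_matI) auto

  have "similar_mat (gain_dist_laplacian G vs \<psi>) (gain_dist_laplacian G vs \<phi>)"
  proof (rule similar_mat_diag_conjugate[where n = n and f = "\<lambda>i. \<zeta> (vs ! i)"])
    show "gain_dist_laplacian G vs \<phi> \<in> carrier_mat n n" "gain_dist_laplacian G vs \<psi> \<in> carrier_mat n n"
      by (simp_all add: gain_dist_laplacian_def transmission_mat_def gain_dist_mat_def
          dist_mat_max_def n_def minus_carrier_mat)
    show "\<zeta> (vs ! i) \<noteq> 0" if "i < n" for i
      using \<zeta>0 verts that by blast
    \<comment> \<open>The transmission part is diagonal and independent of the gains, and on the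
      diagonal the two switching factors cancel; off the diagonal only the gain distance entry
      remains.\<close>
    show "gain_dist_laplacian G vs \<psi> $$ (i, j) =
        \<zeta> (vs ! i) * gain_dist_laplacian G vs \<phi> $$ (i, j) * inverse (\<zeta> (vs ! j))"
      if "i < n" "j < n" for i j
      using conjunct2[OF gain[OF that]] \<zeta>0[OF verts[OF that(1)]] \<zeta>0[OF verts[OF that(2)]] that
      by (auto simp: gain_dist_laplacian_def transmission_mat_def gain_dist_mat_def
          dist_mat_max_def n_def[symmetric] field_simps)
  qed
  then show "mspectrum (gain_dist_laplacian G vs \<phi>) = mspectrum (gain_dist_laplacian G vs \<psi>)"
    by (simp add: mspectrum_def char_poly_similar)
qed

end
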